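(* An element $x$ of an algebraic dcpo $D$ is sharp if and only if for every compact $c\in D$ it is decidable whether $c\sqsubseteq x$ holds.
   Context: Everything is constructive: neither excluded middle nor choice is assumed. A proposition $P$ is decidable if $P\vee\lnot P$ holds. A subset $S$ of a poset is directed if it is inhabited and any two elements of $S$ have an upper bound in $S$. A dcpo is a poset $(D,\sqsubseteq)$ in which every directed subset $S$ has a supremum $\bigsqcup S$. Write $x\ll y$ ($x$ is way below $y$) if for every directed $S$ with $y\sqsubseteq\bigsqcup S$ there is $s\in S$ with $x\sqsubseteq s$. An element $c$ is compact if $c\ll c$. $D$ is algebraic if for every $x\in D$ the set $\{c\in D\mid c\sqsubseteq x,\ c\text{ compact}\}$ is directed with supremum $x$. An element $x\in D$ is sharp if for every $y,z\in D$ with $y\ll z$ we have $y\ll x$ or $\lnot(z\sqsubseteq x)$. *)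

theory Defs
  imports Main
begin

text \<open>
  In HOL every proposition is decidable, so a direct transcription of a constructive
  statement about decidability would be void. We therefore represent the constructive
  meta-theory explicitly: a statement about posets is a formula of intuitionistic second-order
  logic, and asserting it means that it is derivable. There is a sort of elements of
  \<open>D\<close> with equality and \<open>\<sqsubseteq>\<close>, and a sort of subsets of \<open>D\<close>, with full comprehension; excluded
  middle and choice are absent.

  Variables are de Bruijn indices, with one index space per sort: an element quantifier
  (\<open>\<^bold>\<forall>\<close>, \<open>\<^bold>\<exists>\<close>) does not shift the indices of set variables, nor a set quantifier
  (\<open>\<^bold>\<forall>\<^sub>S\<close>, \<open>\<^bold>\<exists>\<^sub>S\<close>) those of element variables. In \<open>0 \<^bold>\<in> 0\<close> the left-hand \<open>0\<close> is an element variable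
  and the right-hand \<open>0\<close> a set variable.
\<close>

datatype fm =
    Falsum  ("\<^bold>\<bottom>")
  | Eq nat nat  (infix "\<^bold>=" 70)
  | Le nat nat  (infix "\<^bold>\<sqsubseteq>" 70)
  | Mem nat nat  (infix "\<^bold>\<in>" 70)
  | Con fm fm  (infixr "\<^bold>\<and>" 65)
  | Dis fm fm  (infixr "\<^bold>\<or>" 60)
  | Imp fm fm  (infixr "\<^bold>\<longrightarrow>" 55)
  | All fm  ("\<^bold>\<forall> _" [66] 66)
  | Exi fm  ("\<^bold>\<exists> _" [66] 66)
  | AllS fm  ("\<^bold>\<forall>\<^sub>S _" [66] 66)
  | ExiS fm  ("\<^bold>\<exists>\<^sub>S _" [66] 66)

definition Neg :: "fm \<Rightarrow> fm"  ("\<^bold>\<not> _" [68] 68)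
  where "\<^bold>\<not> p = (p \<^bold>\<longrightarrow> \<^bold>\<bottom>)"

definition Iff :: "fm \<Rightarrow> fm \<Rightarrow> fm"  (infix "\<^bold>\<longleftrightarrow>" 53)
  where "(p \<^bold>\<longleftrightarrow> q) = ((p \<^bold>\<longrightarrow> q) \<^bold>\<and> (q \<^bold>\<longrightarrow> p))"


section \<open>Intuitionistic second-order derivability\<close>

text \<open>
  There are no compound terms, so substitution is renaming: \<open>ren f g p\<close> applies \<open>f\<close> to the free
  element variables and \<open>g\<close> to the free set variables.
\<close>

definition up :: "(nat \<Rightarrow> nat) \<Rightarrow> nat \<Rightarrow> nat"
  where "up f = case_nat 0 (\<lambda>n. Suc (f n))"

primrec ren :: "(nat \<Rightarrow> nat) \<Rightarrow> (nat \<Rightarrow> nat) \<Rightarrow> fm \<Rightarrow> fm" where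
  "ren f g \<^bold>\<bottom> = \<^bold>\<bottom>"
| "ren f g (x \<^bold>= y) = (f x \<^bold>= f y)"
| "ren f g (x \<^bold>\<sqsubseteq> y) = (f x \<^bold>\<sqsubseteq> f y)"
| "ren f g (x \<^bold>\<in> S) = (f x \<^bold>\<in> g S)"
| "ren f g (p \<^bold>\<and> q) = (ren f g p \<^bold>\<and> ren f g q)"
| "ren f g (p \<^bold>\<or> q) = (ren f g p \<^bold>\<or> ren f g q)"
| "ren f g (p \<^bold>\<longrightarrow> q) = (ren f g p \<^bold>\<longrightarrow> ren f g q)"
| "ren f g (\<^bold>\<forall> p) = \<^bold>\<forall> (ren (up f) g p)"
| "ren f g (\<^bold>\<exists> p) = \<^bold>\<exists> (ren (up f) g p)"
| "ren f g (\<^bold>\<forall>\<^sub>S p) = \<^bold>\<forall>\<^sub>S (ren f (up g) p)"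
| "ren f g (\<^bold>\<exists>\<^sub>S p) = \<^bold>\<exists>\<^sub>S (ren f (up g) p)"

abbreviation lift :: "fm \<Rightarrow> fm" where "lift \<equiv> ren Suc id"
abbreviation liftS :: "fm \<Rightarrow> fm" where "liftS \<equiv> ren id Suc"
abbreviation inst :: "fm \<Rightarrow> nat \<Rightarrow> fm" where "inst p x \<equiv> ren (case_nat x id) id p"
abbreviation instS :: "fm \<Rightarrow> nat \<Rightarrow> fm" where "instS p S \<equiv> ren id (case_nat S id) p"

text \<open>
  In \<open>Compr\<close> the formula \<open>p\<close> is arbitrary (impredicative comprehension); its variable \<open>0\<close> is the
  element being collected, and \<open>liftS\<close> keeps the new set from occurring in it.
\<close>

inductive derives :: "fm list \<Rightarrow> fm \<Rightarrow> bool"  (infix "\<turnstile>" 50) where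
  Asm: "p \<in> set \<Gamma> \<Longrightarrow> \<Gamma> \<turnstile> p"
| FalsumE: "\<Gamma> \<turnstile> \<^bold>\<bottom> \<Longrightarrow> \<Gamma> \<turnstile> p"
| ConI: "\<Gamma> \<turnstile> p \<Longrightarrow> \<Gamma> \<turnstile> q \<Longrightarrow> \<Gamma> \<turnstile> (p \<^bold>\<and> q)"
| ConE1: "\<Gamma> \<turnstile> (p \<^bold>\<and> q) \<Longrightarrow> \<Gamma> \<turnstile> p"
| ConE2: "\<Gamma> \<turnstile> (p \<^bold>\<and> q) \<Longrightarrow> \<Gamma> \<turnstile> q"
| DisI1: "\<Gamma> \<turnstile> p \<Longrightarrow> \<Gamma> \<turnstile> (p \<^bold>\<or> q)"
| DisI2: "\<Gamma> \<turnstile> q \<Longrightarrow> \<Gamma> \<turnstile> (p \<^bold>\<or> q)"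
| DisE: "\<Gamma> \<turnstile> (p \<^bold>\<or> q) \<Longrightarrow> p # \<Gamma> \<turnstile> r \<Longrightarrow> q # \<Gamma> \<turnstile> r \<Longrightarrow> \<Gamma> \<turnstile> r"
| ImpI: "p # \<Gamma> \<turnstile> q \<Longrightarrow> \<Gamma> \<turnstile> (p \<^bold>\<longrightarrow> q)"
| ImpE: "\<Gamma> \<turnstile> (p \<^bold>\<longrightarrow> q) \<Longrightarrow> \<Gamma> \<turnstile> p \<Longrightarrow> \<Gamma> \<turnstile> q"
| AllI: "map lift \<Gamma> \<turnstile> p \<Longrightarrow> \<Gamma> \<turnstile> \<^bold>\<forall> p"
| AllE: "\<Gamma> \<turnstile> \<^bold>\<forall> p \<Longrightarrow> \<Gamma> \<turnstile> inst p x"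
| ExiI: "\<Gamma> \<turnstile> inst p x \<Longrightarrow> \<Gamma> \<turnstile> \<^bold>\<exists> p"
| ExiE: "\<Gamma> \<turnstile> \<^bold>\<exists> p \<Longrightarrow> p # map lift \<Gamma> \<turnstile> lift q \<Longrightarrow> \<Gamma> \<turnstile> q"
| AllSI: "map liftS \<Gamma> \<turnstile> p \<Longrightarrow> \<Gamma> \<turnstile> \<^bold>\<forall>\<^sub>S p"
| AllSE: "\<Gamma> \<turnstile> \<^bold>\<forall>\<^sub>S p \<Longrightarrow> \<Gamma> \<turnstile> instS p S"
| ExiSI: "\<Gamma> \<turnstile> instS p S \<Longrightarrow> \<Gamma> \<turnstile> \<^bold>\<exists>\<^sub>S p"
| ExiSE: "\<Gamma> \<turnstile> \<^bold>\<exists>\<^sub>S p \<Longrightarrow> p # map liftS \<Gamma> \<turnstile> liftS q \<Longrightarrow> \<Gamma> \<turnstile> q"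
| EqI: "\<Gamma> \<turnstile> (x \<^bold>= x)"
| EqE: "\<Gamma> \<turnstile> (x \<^bold>= y) \<Longrightarrow> \<Gamma> \<turnstile> inst p x \<Longrightarrow> \<Gamma> \<turnstile> inst p y"
| Compr: "\<Gamma> \<turnstile> \<^bold>\<exists>\<^sub>S \<^bold>\<forall> (0 \<^bold>\<in> 0 \<^bold>\<longleftrightarrow> liftS p)"

text \<open>
  As usual in first-order calculi, free element variables make \<open>\<^bold>\<exists> (0 \<^bold>= 0)\<close> derivable, so \<open>D\<close> is
  inhabited. This is harmless for a statement that begins with ``for every \<open>x \<in> D\<close>''.
\<close>


section \<open>Domain theory in the object language\<close>

definition decidable :: "fm \<Rightarrow> fm"
  where "decidable p = (p \<^bold>\<or> \<^bold>\<not> p)"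

definition poset :: fm
  where "poset =
    (\<^bold>\<forall> (0 \<^bold>\<sqsubseteq> 0) \<^bold>\<and>
     \<^bold>\<forall> \<^bold>\<forall> \<^bold>\<forall> (2 \<^bold>\<sqsubseteq> 1 \<^bold>\<longrightarrow> 1 \<^bold>\<sqsubseteq> 0 \<^bold>\<longrightarrow> 2 \<^bold>\<sqsubseteq> 0) \<^bold>\<and>
     \<^bold>\<forall> \<^bold>\<forall> (1 \<^bold>\<sqsubseteq> 0 \<^bold>\<longrightarrow> 0 \<^bold>\<sqsubseteq> 1 \<^bold>\<longrightarrow> 1 \<^bold>= 0))"

definition directed :: "nat \<Rightarrow> fm"
  where "directed S =
    (\<^bold>\<exists> (0 \<^bold>\<in> S) \<^bold>\<and>
     \<^bold>\<forall> \<^bold>\<forall> (1 \<^bold>\<in> S \<^bold>\<longrightarrow> 0 \<^bold>\<in> S \<^bold>\<longrightarrow> \<^bold>\<exists> (0 \<^bold>\<in> S \<^bold>\<and> 2 \<^bold>\<sqsubseteq> 0 \<^bold>\<and> 1 \<^bold>\<sqsubseteq> 0)))"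

definition upper_bound :: "nat \<Rightarrow> nat \<Rightarrow> fm"
  where "upper_bound S u = \<^bold>\<forall> (0 \<^bold>\<in> S \<^bold>\<longrightarrow> 0 \<^bold>\<sqsubseteq> Suc u)"

definition supremum :: "nat \<Rightarrow> nat \<Rightarrow> fm"
  where "supremum S u = (upper_bound S u \<^bold>\<and> \<^bold>\<forall> (upper_bound S 0 \<^bold>\<longrightarrow> Suc u \<^bold>\<sqsubseteq> 0))"

definition dcpo :: fm
  where "dcpo = (poset \<^bold>\<and> \<^bold>\<forall>\<^sub>S (directed 0 \<^bold>\<longrightarrow> \<^bold>\<exists> (supremum 0 0)))"

text \<open>For all directed \<open>S\<close> with supremum \<open>u\<close>, if \<open>y \<sqsubseteq> u\<close> then there is \<open>s \<in> S\<close> with \<open>x \<sqsubseteq> s\<close>.\<close>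

definition way_below :: "nat \<Rightarrow> nat \<Rightarrow> fm"  (infix "\<^bold>\<lless>" 70)
  where "(x \<^bold>\<lless> y) =
    \<^bold>\<forall>\<^sub>S (directed 0 \<^bold>\<longrightarrow> \<^bold>\<forall> (supremum 0 0 \<^bold>\<longrightarrow> Suc y \<^bold>\<sqsubseteq> 0 \<^bold>\<longrightarrow> \<^bold>\<exists> (0 \<^bold>\<in> 0 \<^bold>\<and> Suc (Suc x) \<^bold>\<sqsubseteq> 0)))"

definition compact :: "nat \<Rightarrow> fm"
  where "compact c = (c \<^bold>\<lless> c)"

text \<open>For every \<open>x\<close> and every \<open>S\<close>, if \<open>S = {c. c \<sqsubseteq> x, c compact}\<close> then \<open>S\<close> is directed with supremum \<open>x\<close>.\<close>

definition algebraic :: fm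
  where "algebraic =
    \<^bold>\<forall> \<^bold>\<forall>\<^sub>S (\<^bold>\<forall> (0 \<^bold>\<in> 0 \<^bold>\<longleftrightarrow> 0 \<^bold>\<sqsubseteq> 1 \<^bold>\<and> compact 0) \<^bold>\<longrightarrow> directed 0 \<^bold>\<and> supremum 0 0)"

definition sharp :: "nat \<Rightarrow> fm"
  where "sharp x =
    \<^bold>\<forall> \<^bold>\<forall> (1 \<^bold>\<lless> 0 \<^bold>\<longrightarrow> 1 \<^bold>\<lless> Suc (Suc x) \<^bold>\<or> \<^bold>\<not> (0 \<^bold>\<sqsubseteq> Suc (Suc x)))"


section \<open>Checks on the calculus and on the formulas\<close>

text \<open>
  Kripke models with a constant domain of elements and equality interpreted as identity; sets are
  monotone families of predicates. Soundness shows that the calculus is consistent and that excluded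
  middle is not derivable.
\<close>

primrec force ::
    "('w::order \<Rightarrow> 'a \<Rightarrow> 'a \<Rightarrow> bool) \<Rightarrow> 'w \<Rightarrow> (nat \<Rightarrow> 'a) \<Rightarrow> (nat \<Rightarrow> 'w \<Rightarrow> 'a \<Rightarrow> bool) \<Rightarrow> fm \<Rightarrow> bool"
  where
  "force R w e s Falsum = False"
| "force R w e s (Eq x y) = (e x = e y)"
| "force R w e s (Le x y) = R w (e x) (e y)"
| "force R w e s (Mem x S) = s S w (e x)"
| "force R w e s (Con p q) = (force R w e s p \<and> force R w e s q)"
| "force R w e s (Dis p q) = (force R w e s p \<or> force R w e s q)"
| "force R w e s (Imp p q) = (\<forall>v\<ge>w. force R v e s p \<longrightarrow> force R v e s q)"
| "force R w e s (All p) = (\<forall>x. force R w (case_nat x e) s p)"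
| "force R w e s (Exi p) = (\<exists>x. force R w (case_nat x e) s p)"
| "force R w e s (AllS p) = (\<forall>X. mono X \<longrightarrow> force R w e (case_nat X s) p)"
| "force R w e s (ExiS p) = (\<exists>X. mono X \<and> force R w e (case_nat X s) p)"

lemma case_nat_up: "(\<lambda>i. case_nat x e (up f i)) = case_nat x (\<lambda>i. e (f i))"
  by (auto simp: up_def fun_eq_iff split: nat.splits)

lemma force_ren: "force R w e s (ren f g p) = force R w (\<lambda>i. e (f i)) (\<lambda>i. s (g i)) p"
  by (induction p arbitrary: w e s f g) (auto simp: case_nat_up)

lemma mono_case_nat: "mono X \<Longrightarrow> (\<And>i. mono (s i)) \<Longrightarrow> mono (case_nat X s i)" by (simp split: nat.split)

lemma force_mono:
  fixes R :: "'w::order \<Rightarrow> 'a \<Rightarrow> 'a \<Rightarrow> bool"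
  assumes R: "mono R"
  shows "(\<And>i. mono (s i)) \<Longrightarrow> w \<le> v \<Longrightarrow> force R w e s p \<Longrightarrow> force R v e s p"
proof (induction p arbitrary: e s)
  case (Le x y)
  then show ?case using monoD[OF R Le.prems(2)] by (auto simp: le_fun_def)
next
  case (Mem x S)
  then show ?case using monoD[OF Mem.prems(1,2)] by (auto simp: le_fun_def)
next
  case (Imp p q)
  then show ?case by (simp add: order_trans[OF Imp.prems(2)])
next
  case (AllS p)
  show ?case unfolding force.simps
  proof (intro allI impI)
    fix X :: "'w \<Rightarrow> 'a \<Rightarrow> bool" assume X: "mono X"
    show "force R v e (case_nat X s) p"
      by (rule AllS.IH[OF mono_case_nat[OF X AllS.prems(1)] AllS.prems(2)]) (use AllS.prems(3) X in simp)
  qed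
next
  case (ExiS p)
  then obtain X where X: "mono X" "force R w e (case_nat X s) p" by auto
  then show ?case using ExiS.IH[OF mono_case_nat[OF X(1) ExiS.prems(1)] ExiS.prems(2) X(2)] by auto
next
  case (All p) then show ?case by simp
next
  case (Exi p) then show ?case by (simp, blast)
next
  case (Con p q) then show ?case by simp
next
  case (Dis p q) then show ?case by (simp, blast)
qed simp_all

lemma case_nat_inst: "(\<lambda>i. e (case_nat x id i)) = case_nat (e x) e"
  by (auto split: nat.splits)

lemma derives_sound:
  assumes R: "mono R"
  shows "\<Gamma> \<turnstile> p \<Longrightarrow> (\<And>i. mono (s i)) \<Longrightarrow> (\<forall>q\<in>set \<Gamma>. force R w e s q) \<Longrightarrow> force R w e s p"
proof (induction \<Gamma> p arbitrary: w e s rule: derives.induct)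
  case (ImpI p \<Gamma> q)
  show ?case unfolding force.simps
  proof (intro allI impI)
    fix v assume v: "w \<le> v" "force R v e s p"
    have "\<forall>r\<in>set (p # \<Gamma>). force R v e s r"
      using ImpI.prems(2) v(2) force_mono[OF R ImpI.prems(1) v(1)] by simp
    then show "force R v e s q" by (rule ImpI.IH[OF ImpI.prems(1)])
  qed
next
  case (ImpE \<Gamma> p q)
  then show ?case by (metis force.simps(7) order_refl)
next
  case (DisE \<Gamma> p q r)
  from DisE.IH(1)[OF DisE.prems] DisE.IH(2)[of s w e] DisE.IH(3)[of s w e] DisE.prems
  show ?case by auto
next
  case (AllI \<Gamma> p) then show ?case by (auto simp: force_ren)
next
  case (AllE \<Gamma> p x) then show ?case by (auto simp: force_ren case_nat_inst)
next
  case (ExiI \<Gamma> p x) then show ?case by (auto simp: force_ren case_nat_inst)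
next
  case (ExiE \<Gamma> p q)
  from ExiE.IH(1)[OF ExiE.prems] obtain x where x: "force R w (case_nat x e) s p" by auto
  show ?case using ExiE.IH(2)[of s w "case_nat x e"] ExiE.prems x by (auto simp: force_ren)
next
  case (AllSI \<Gamma> p) then show ?case by (auto simp: force_ren mono_case_nat)
next
  case (AllSE \<Gamma> p S) then show ?case by (auto simp: force_ren case_nat_inst)
next
  case (ExiSI \<Gamma> p S)
  from ExiSI.IH[OF ExiSI.prems] have "force R w e (case_nat (s S) s) p" by (simp add: force_ren case_nat_inst)
  then show ?case using ExiSI.prems(1) by auto
next
  case (ExiSE \<Gamma> p q)
  from ExiSE.IH(1)[OF ExiSE.prems] obtain X where x: "mono X" "force R w e (case_nat X s) p" by auto
  show ?case using ExiSE.IH(2)[of "case_nat X s" w e] ExiSE.prems x by (auto simp: force_ren mono_case_nat)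
next
  case (EqE \<Gamma> x y p)
  from EqE.IH(1)[OF EqE.prems] have "case_nat (e x) e = case_nat (e y) e" by simp
  with EqE.IH(2)[OF EqE.prems] show ?case by (simp only: force_ren case_nat_inst id_apply)
next
  case (Compr \<Gamma> p)
  have "mono (\<lambda>w x. force R w (case_nat x e) s p)"
    unfolding mono_def le_fun_def using force_mono[OF R] Compr by auto
  then show ?case by (auto simp: Iff_def force_ren intro!: exI[of _ "\<lambda>w x. force R w (case_nat x e) s p"])
qed auto

lemma excluded_middle_not_derivable: "\<not> [] \<turnstile> (0 \<^bold>\<sqsubseteq> 1 \<^bold>\<or> \<^bold>\<not> (0 \<^bold>\<sqsubseteq> 1))"
proof
  assume d: "[] \<turnstile> (0 \<^bold>\<sqsubseteq> 1 \<^bold>\<or> \<^bold>\<not> (0 \<^bold>\<sqsubseteq> 1))"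
  have "mono (\<lambda>(w::bool) (x::bool) (y::bool). w)" by (auto simp: mono_def le_fun_def)
  from derives_sound[OF this d, of "\<lambda>_ _ _. True" False "\<lambda>_. True"] show False by (auto simp: Neg_def mono_def)
qed

text \<open>
  With a single world, forcing is ordinary truth in HOL, and the formulas acquire their
  textbook meaning.
\<close>

abbreviation holds ::
    "('a \<Rightarrow> 'a \<Rightarrow> bool) \<Rightarrow> (nat \<Rightarrow> 'a) \<Rightarrow> (nat \<Rightarrow> unit \<Rightarrow> 'a \<Rightarrow> bool) \<Rightarrow> fm \<Rightarrow> bool"
  where "holds R e s p \<equiv> force (\<lambda>_. R) () e s p"

definition is_directed :: "('a \<Rightarrow> 'a \<Rightarrow> bool) \<Rightarrow> 'a set \<Rightarrow> bool"
  where "is_directed R A \<longleftrightarrow> A \<noteq> {} \<and> (\<forall>x\<in>A. \<forall>y\<in>A. \<exists>z\<in>A. R x z \<and> R y z)"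

definition is_lub :: "('a \<Rightarrow> 'a \<Rightarrow> bool) \<Rightarrow> 'a set \<Rightarrow> 'a \<Rightarrow> bool"
  where "is_lub R A u \<longleftrightarrow> (\<forall>x\<in>A. R x u) \<and> (\<forall>v. (\<forall>x\<in>A. R x v) \<longrightarrow> R u v)"

definition is_way_below :: "('a \<Rightarrow> 'a \<Rightarrow> bool) \<Rightarrow> 'a \<Rightarrow> 'a \<Rightarrow> bool"
  where "is_way_below R x y \<longleftrightarrow>
    (\<forall>A. is_directed R A \<longrightarrow> (\<forall>u. is_lub R A u \<longrightarrow> R y u \<longrightarrow> (\<exists>s\<in>A. R x s)))"

lemma mono_unit[simp]: "mono (X::unit \<Rightarrow> 'b::order)" by (auto simp: mono_def)

lemma all_unit_pred: "(\<forall>X::unit\<Rightarrow>'a\<Rightarrow>bool. P X) \<longleftrightarrow> (\<forall>A. P (\<lambda>_ x. x\<in>A))"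
proof (rule iffI; intro allI)
  fix A assume "\<forall>X. P X" then show "P (\<lambda>_ x. x \<in> A)" by (rule spec)
next
  fix X assume "\<forall>A. P (\<lambda>_ x. x \<in> A)"
  then have "P (\<lambda>_ x. x \<in> Collect (X ()))" by blast
  moreover have "(\<lambda>_ x. x \<in> Collect (X ())) = X" by auto
  ultimately show "P X" by simp
qed

lemma holds_directed: "holds R e s (directed S) \<longleftrightarrow> is_directed R {x. s S () x}"
  by (auto simp: directed_def is_directed_def eval_nat_numeral)

lemma holds_supremum: "holds R e s (supremum S u) \<longleftrightarrow> is_lub R {x. s S () x} (e u)"
  by (auto simp: supremum_def upper_bound_def is_lub_def)

lemma holds_way_below: "holds R e s (x \<^bold>\<lless> y) \<longleftrightarrow> is_way_below R (e x) (e y)"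
  by (simp add: way_below_def is_way_below_def holds_directed holds_supremum all_unit_pred Bex_def)

lemma holds_dcpo: "holds R e s dcpo \<longleftrightarrow>
    reflp R \<and> transp R \<and> antisymp R \<and> (\<forall>A. is_directed R A \<longrightarrow> (\<exists>u. is_lub R A u))"
  by (auto simp: dcpo_def poset_def holds_directed holds_supremum
      all_unit_pred reflp_def transp_def antisymp_def eval_nat_numeral)

lemma holds_Imp: "holds R e s (p \<^bold>\<longrightarrow> q) \<longleftrightarrow> (holds R e s p \<longrightarrow> holds R e s q)" by simp

lemma holds_Iff: "holds R e s (p \<^bold>\<longleftrightarrow> q) \<longleftrightarrow> (holds R e s p \<longleftrightarrow> holds R e s q)" by (auto simp: Iff_def)

lemma holds_algebraic: "holds R e s algebraic \<longleftrightarrow>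
    (\<forall>x. is_directed R {c. R c x \<and> is_way_below R c c} \<and> is_lub R {c. R c x \<and> is_way_below R c c} x)"
proof -
  have "holds R e s algebraic \<longleftrightarrow>
      (\<forall>x A. (\<forall>c. c \<in> A \<longleftrightarrow> R c x \<and> is_way_below R c c) \<longrightarrow> is_directed R A \<and> is_lub R A x)"
    unfolding algebraic_def compact_def
    by (simp only: force.simps(4,3,5,8,10) holds_Imp holds_Iff
        holds_directed holds_supremum holds_way_below all_unit_pred
        nat.case One_nat_def Collect_mem_eq mono_unit simp_thms)
  also have "\<dots> \<longleftrightarrow> (\<forall>x A. A = {c. R c x \<and> is_way_below R c c} \<longrightarrow> is_directed R A \<and> is_lub R A x)"
    by (simp only: set_eq_iff mem_Collect_eq)
  finally show ?thesis by simp
qed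

lemma holds_sharp: "holds R e s (sharp x) \<longleftrightarrow>
    (\<forall>y z. is_way_below R y z \<longrightarrow> is_way_below R y (e x) \<or> \<not> R z (e x))"
  by (simp add: sharp_def Neg_def holds_way_below)

end

theory Submission
  imports Defs
begin

text \<open>
  If \<open>y \<lless> z\<close> then, \<open>z\<close> being the directed supremum of the compact elements below it, some
  compact \<open>c \<sqsubseteq> z\<close> has \<open>y \<sqsubseteq> c\<close>; conversely \<open>y \<sqsubseteq> c \<sqsubseteq> x\<close> with \<open>c\<close> compact gives \<open>y \<lless> x\<close>.
  So for compact \<open>c\<close> the relations \<open>c \<lless> x\<close> and \<open>c \<sqsubseteq> x\<close> agree, and sharpness applied to
  \<open>c \<lless> c\<close> decides \<open>c \<sqsubseteq> x\<close>. In the other direction, given \<open>y \<lless> z\<close>, interpolate such a \<open>c\<close>: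
  if \<open>c \<sqsubseteq> x\<close> then \<open>y \<lless> x\<close>, and if \<open>\<not> c \<sqsubseteq> x\<close> then \<open>\<not> z \<sqsubseteq> x\<close>.
\<close>

section \<open>Structural rules\<close>

lemma up_simps [simp]: "up f 0 = 0" "up f (Suc n) = Suc (f n)"
  by (simp_all add: up_def)

text \<open>Contexts are compared as sets, so this also covers exchange and contraction. In the
  induction \<open>\<Delta>\<close> must be arbitrary, since rules that discharge hypotheses or bind
  variables change the context; the inclusion survives both an added hypothesis and a shift by
  \<open>lift\<close> or \<open>liftS\<close>.\<close>

lemma weakening: "\<Gamma> \<turnstile> p \<Longrightarrow> set \<Gamma> \<subseteq> set \<Delta> \<Longrightarrow> \<Delta> \<turnstile> p"
proof (induction arbitrary: \<Delta> rule: derives.induct)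
  case (DisE \<Gamma> p q r)
  have "p # \<Delta> \<turnstile> r" using DisE.prems by (intro DisE.IH(2)) auto
  moreover have "q # \<Delta> \<turnstile> r" using DisE.prems by (intro DisE.IH(3)) auto
  ultimately show ?case by (rule derives.DisE[OF DisE.IH(1)[OF DisE.prems]])
next
  case (ImpI p \<Gamma> q)
  then show ?case by (intro derives.ImpI ImpI.IH) auto
next
  case (AllI \<Gamma> p)
  then show ?case by (intro derives.AllI AllI.IH) auto
next
  case (AllSI \<Gamma> p)
  then show ?case by (intro derives.AllSI AllSI.IH) auto
next
  case (ExiE \<Gamma> p q)
  have "p # map lift \<Delta> \<turnstile> lift q" using ExiE.prems by (intro ExiE.IH(2)) auto
  with ExiE.IH(1)[OF ExiE.prems] show ?case by (rule derives.ExiE)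
next
  case (ExiSE \<Gamma> p q)
  have "p # map liftS \<Delta> \<turnstile> liftS q" using ExiSE.prems by (intro ExiSE.IH(2)) auto
  with ExiSE.IH(1)[OF ExiSE.prems] show ?case by (rule derives.ExiSE)
next
  case (EqE \<Gamma> x y p)
  then show ?case by (intro derives.EqE[OF EqE.IH(1) EqE.IH(2)])
qed (auto intro: derives.intros)

text \<open>Transports a sequent proved for a concrete list of hypotheses into any context that
  derives them.\<close>

lemma cut: "\<Delta> \<turnstile> p \<Longrightarrow> (\<And>q. q \<in> set \<Delta> \<Longrightarrow> \<Gamma> \<turnstile> q) \<Longrightarrow> \<Gamma> \<turnstile> p"
proof (induction \<Delta> arbitrary: p)
  case Nil
  then show ?case by (auto intro: weakening)
next
  case (Cons q \<Delta>)
  \<comment> \<open>Moving \<open>q\<close> into the goal changes the formula to be derived, hence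
    the generalisation over \<open>p\<close> in the induction.\<close>
  have "\<Gamma> \<turnstile> (q \<^bold>\<longrightarrow> p)" using Cons by (auto intro: ImpI)
  then show ?case using Cons.prems(2) by (auto intro: ImpE)
qed

section \<open>Derived rules for the domain-theoretic formulas\<close>

lemma ren_Neg [simp]: "ren f g (\<^bold>\<not> p) = (\<^bold>\<not> ren f g p)"
  by (simp add: Neg_def)

lemma ren_Iff [simp]: "ren f g (p \<^bold>\<longleftrightarrow> q) = (ren f g p \<^bold>\<longleftrightarrow> ren f g q)"
  by (simp add: Iff_def)

lemma ren_decidable [simp]: "ren f g (decidable p) = decidable (ren f g p)"
  by (simp add: decidable_def)

lemma ren_directed [simp]: "ren f g (directed S) = directed (g S)"
  by (simp add: directed_def eval_nat_numeral)

lemma ren_supremum [simp]: "ren f g (supremum S u) = supremum (g S) (f u)"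
  by (simp add: supremum_def upper_bound_def)

text \<open>A closed formula is fixed by every renaming, so this axiom on \<open>D\<close> passes
  unchanged through the context shifts of the quantifier rules.\<close>

lemma ren_dcpo [simp]: "ren f g dcpo = dcpo"
  by (simp add: dcpo_def poset_def eval_nat_numeral)

lemma ren_way_below [simp]: "ren f g (x \<^bold>\<lless> y) = (f x \<^bold>\<lless> f y)"
  by (simp add: way_below_def)

lemma ren_compact [simp]: "ren f g (compact c) = compact (f c)"
  by (simp add: compact_def)

lemma ren_algebraic [simp]: "ren f g algebraic = algebraic"
  by (simp add: algebraic_def)

lemma ren_sharp [simp]: "ren f g (sharp x) = sharp (f x)"
  by (simp add: sharp_def)

section \<open>Natural-deduction rules for the defined formulas\<close>

lemma IffD1: "\<Gamma> \<turnstile> (p \<^bold>\<longleftrightarrow> q) \<Longrightarrow> \<Gamma> \<turnstile> p \<Longrightarrow> \<Gamma> \<turnstile> q"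
  unfolding Iff_def by (blast intro: ConE1 ImpE)

lemma IffI: "p # \<Gamma> \<turnstile> q \<Longrightarrow> q # \<Gamma> \<turnstile> p \<Longrightarrow> \<Gamma> \<turnstile> (p \<^bold>\<longleftrightarrow> q)"
  unfolding Iff_def by (intro ConI ImpI)

lemma dcpo_refl:
  assumes "\<Gamma> \<turnstile> dcpo"
  shows "\<Gamma> \<turnstile> (x \<^bold>\<sqsubseteq> x)"
proof -
  have "\<Gamma> \<turnstile> \<^bold>\<forall> (0 \<^bold>\<sqsubseteq> 0)" using assms unfolding dcpo_def poset_def by (blast intro: ConE1)
  from AllE[OF this, of x] show ?thesis by simp
qed

lemma dcpo_trans:
  assumes "\<Gamma> \<turnstile> dcpo" "\<Gamma> \<turnstile> (x \<^bold>\<sqsubseteq> y)" "\<Gamma> \<turnstile> (y \<^bold>\<sqsubseteq> z)"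
  shows "\<Gamma> \<turnstile> (x \<^bold>\<sqsubseteq> z)"
proof -
  have "\<Gamma> \<turnstile> \<^bold>\<forall> \<^bold>\<forall> \<^bold>\<forall> (2 \<^bold>\<sqsubseteq> 1 \<^bold>\<longrightarrow> 1 \<^bold>\<sqsubseteq> 0 \<^bold>\<longrightarrow> 2 \<^bold>\<sqsubseteq> 0)"
    using assms(1) unfolding dcpo_def poset_def by (blast intro: ConE1 ConE2)
  \<comment> \<open>Two binders remain, so the chosen \<open>x\<close> is shifted past them; each
    later instantiation removes one \<open>Suc\<close>.\<close>
  from AllE[OF this, of x] have "\<Gamma> \<turnstile> \<^bold>\<forall> \<^bold>\<forall> (Suc (Suc x) \<^bold>\<sqsubseteq> 1 \<^bold>\<longrightarrow> 1 \<^bold>\<sqsubseteq> 0 \<^bold>\<longrightarrow> Suc (Suc x) \<^bold>\<sqsubseteq> 0)"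
    by (simp add: eval_nat_numeral)
  from AllE[OF this, of y] have "\<Gamma> \<turnstile> \<^bold>\<forall> (Suc x \<^bold>\<sqsubseteq> Suc y \<^bold>\<longrightarrow> Suc y \<^bold>\<sqsubseteq> 0 \<^bold>\<longrightarrow> Suc x \<^bold>\<sqsubseteq> 0)"
    by simp
  from AllE[OF this, of z] have "\<Gamma> \<turnstile> (x \<^bold>\<sqsubseteq> y \<^bold>\<longrightarrow> y \<^bold>\<sqsubseteq> z \<^bold>\<longrightarrow> x \<^bold>\<sqsubseteq> z)"
    by simp
  with assms show ?thesis by (blast intro: ImpE)
qed

lemma supremum_upper:
  assumes "\<Gamma> \<turnstile> supremum S u" "\<Gamma> \<turnstile> (x \<^bold>\<in> S)"
  shows "\<Gamma> \<turnstile> (x \<^bold>\<sqsubseteq> u)"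
proof -
  have "\<Gamma> \<turnstile> \<^bold>\<forall> (0 \<^bold>\<in> S \<^bold>\<longrightarrow> 0 \<^bold>\<sqsubseteq> Suc u)"
    using assms(1) unfolding supremum_def upper_bound_def by (rule ConE1)
  from AllE[OF this, of x] have "\<Gamma> \<turnstile> (x \<^bold>\<in> S \<^bold>\<longrightarrow> x \<^bold>\<sqsubseteq> u)" by simp
  with assms(2) show ?thesis by (blast intro: ImpE)
qed

lemma way_belowD:
  assumes "\<Gamma> \<turnstile> (x \<^bold>\<lless> y)" "\<Gamma> \<turnstile> directed S" "\<Gamma> \<turnstile> supremum S u" "\<Gamma> \<turnstile> (y \<^bold>\<sqsubseteq> u)"
  shows "\<Gamma> \<turnstile> \<^bold>\<exists> (0 \<^bold>\<in> S \<^bold>\<and> Suc x \<^bold>\<sqsubseteq> 0)"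
proof -
  from AllSE[OF assms(1)[unfolded way_below_def], of S]
  have "\<Gamma> \<turnstile> (directed S \<^bold>\<longrightarrow>
      \<^bold>\<forall> (supremum S 0 \<^bold>\<longrightarrow> Suc y \<^bold>\<sqsubseteq> 0 \<^bold>\<longrightarrow> \<^bold>\<exists> (0 \<^bold>\<in> S \<^bold>\<and> Suc (Suc x) \<^bold>\<sqsubseteq> 0)))"
    by simp
  from AllE[OF ImpE[OF this assms(2)], of u]
  have "\<Gamma> \<turnstile> (supremum S u \<^bold>\<longrightarrow> y \<^bold>\<sqsubseteq> u \<^bold>\<longrightarrow> \<^bold>\<exists> (0 \<^bold>\<in> S \<^bold>\<and> Suc x \<^bold>\<sqsubseteq> 0))" by simp
  with assms(3,4) show ?thesis by (blast intro: ImpE)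
qed

text \<open>The directed set and its supremum are each variable \<open>0\<close> of their own sort.
  Only the supremum shifts element indices, and the existential adds one more \<open>Suc\<close> to
  \<open>x\<close>.\<close>

lemma way_belowI:
  assumes "(Suc y \<^bold>\<sqsubseteq> 0) # supremum 0 0 # map lift (directed 0 # map liftS \<Gamma>)
    \<turnstile> \<^bold>\<exists> (0 \<^bold>\<in> 0 \<^bold>\<and> Suc (Suc x) \<^bold>\<sqsubseteq> 0)"
  shows "\<Gamma> \<turnstile> (x \<^bold>\<lless> y)"
  unfolding way_below_def using assms by (intro AllSI AllI ImpI)

text \<open>There are no set terms, so the set of compact elements below \<open>x\<close> is
  represented by any set variable \<open>S\<close> with the right membership equivalence.\<close>

lemma algebraicD:
  assumes "\<Gamma> \<turnstile> algebraic" "\<Gamma> \<turnstile> \<^bold>\<forall> (0 \<^bold>\<in> S \<^bold>\<longleftrightarrow> 0 \<^bold>\<sqsubseteq> Suc x \<^bold>\<and> compact 0)"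
  shows "\<Gamma> \<turnstile> directed S" "\<Gamma> \<turnstile> supremum S x"
proof -
  from AllE[OF assms(1)[unfolded algebraic_def], of x]
  have "\<Gamma> \<turnstile> \<^bold>\<forall>\<^sub>S (\<^bold>\<forall> (0 \<^bold>\<in> 0 \<^bold>\<longleftrightarrow> 0 \<^bold>\<sqsubseteq> Suc x \<^bold>\<and> compact 0) \<^bold>\<longrightarrow> directed 0 \<^bold>\<and> supremum 0 x)"
    by simp
  from AllSE[OF this, of S]
  have "\<Gamma> \<turnstile> (\<^bold>\<forall> (0 \<^bold>\<in> S \<^bold>\<longleftrightarrow> 0 \<^bold>\<sqsubseteq> Suc x \<^bold>\<and> compact 0) \<^bold>\<longrightarrow> directed S \<^bold>\<and> supremum S x)"
    by simp
  from ImpE[OF this assms(2)] show "\<Gamma> \<turnstile> directed S" "\<Gamma> \<turnstile> supremum S x"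
    by (blast intro: ConE1 ConE2)+
qed

lemma sharpD:
  assumes "\<Gamma> \<turnstile> sharp x" "\<Gamma> \<turnstile> (y \<^bold>\<lless> z)"
  shows "\<Gamma> \<turnstile> (y \<^bold>\<lless> x \<^bold>\<or> \<^bold>\<not> (z \<^bold>\<sqsubseteq> x))"
proof -
  from AllE[OF assms(1)[unfolded sharp_def], of y]
  have "\<Gamma> \<turnstile> \<^bold>\<forall> (Suc y \<^bold>\<lless> 0 \<^bold>\<longrightarrow> Suc y \<^bold>\<lless> Suc x \<^bold>\<or> \<^bold>\<not> (0 \<^bold>\<sqsubseteq> Suc x))" by simp
  from AllE[OF this, of z] have "\<Gamma> \<turnstile> (y \<^bold>\<lless> z \<^bold>\<longrightarrow> y \<^bold>\<lless> x \<^bold>\<or> \<^bold>\<not> (z \<^bold>\<sqsubseteq> x))" by simp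
  from ImpE[OF this assms(2)] show ?thesis .
qed

section \<open>Interpolation by compact elements\<close>

text \<open>Comprehension supplies the set of compact elements below \<open>y\<close>; algebraicity
  makes it directed with supremum \<open>y\<close>, and \<open>x \<lless> y\<close> is tested on it
  with \<open>y \<sqsubseteq> y\<close>. The context is a concrete list, so that its shifts are
  computed by simplification.\<close>

lemma compact_interpolation:
  "[x \<^bold>\<lless> y, dcpo, algebraic] \<turnstile> \<^bold>\<exists> (0 \<^bold>\<sqsubseteq> Suc y \<^bold>\<and> compact 0 \<^bold>\<and> Suc x \<^bold>\<sqsubseteq> 0)" (is "?\<Gamma> \<turnstile> ?p")
proof -
  define K where "K = \<^bold>\<forall> (0 \<^bold>\<in> 0 \<^bold>\<longleftrightarrow> 0 \<^bold>\<sqsubseteq> Suc y \<^bold>\<and> compact 0)"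
  have "?\<Gamma> \<turnstile> \<^bold>\<exists>\<^sub>S K"
    using Compr[of ?\<Gamma> "0 \<^bold>\<sqsubseteq> Suc y \<^bold>\<and> compact 0"] by (simp add: K_def)
  then show ?thesis
  proof (rule ExiSE)
    \<comment> \<open>Opening the set existential shifts set variables only: \<open>x\<close> and
      \<open>y\<close> keep their indices, and the new set is set variable \<open>0\<close>.\<close>
    let ?\<Delta> = "[K, x \<^bold>\<lless> y, dcpo, algebraic]"
    have "?\<Delta> \<turnstile> algebraic" "?\<Delta> \<turnstile> \<^bold>\<forall> (0 \<^bold>\<in> 0 \<^bold>\<longleftrightarrow> 0 \<^bold>\<sqsubseteq> Suc y \<^bold>\<and> compact 0)"
      by (simp_all add: Asm flip: K_def)
    note K = algebraicD[OF this]
    have "?\<Delta> \<turnstile> (x \<^bold>\<lless> y)" "?\<Delta> \<turnstile> (y \<^bold>\<sqsubseteq> y)" by (simp_all add: Asm dcpo_refl)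
    then have "?\<Delta> \<turnstile> \<^bold>\<exists> (0 \<^bold>\<in> 0 \<^bold>\<and> Suc x \<^bold>\<sqsubseteq> 0)" using K by (blast intro: way_belowD)
    then have "?\<Delta> \<turnstile> ?p"
    proof (rule ExiE)
      let ?\<Theta> = "(0 \<^bold>\<in> 0 \<^bold>\<and> Suc x \<^bold>\<sqsubseteq> 0) # map lift ?\<Delta>"
      have "?\<Theta> \<turnstile> (0 \<^bold>\<in> 0 \<^bold>\<and> Suc x \<^bold>\<sqsubseteq> 0)" by (simp add: Asm)
      then have s: "?\<Theta> \<turnstile> (0 \<^bold>\<in> 0)" "?\<Theta> \<turnstile> (Suc x \<^bold>\<sqsubseteq> 0)" by (rule ConE1, rule ConE2)
      \<comment> \<open>The chosen member of the set is now element variable \<open>0\<close>.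
        \<open>K\<close> was shifted with the context, so its bound is \<open>Suc (Suc y)\<close>
        until it is instantiated at that member.\<close>
      have "?\<Theta> \<turnstile> \<^bold>\<forall> (0 \<^bold>\<in> 0 \<^bold>\<longleftrightarrow> 0 \<^bold>\<sqsubseteq> Suc (Suc y) \<^bold>\<and> compact 0)"
        by (rule Asm) (simp add: K_def)
      from AllE[OF this, of 0] have "?\<Theta> \<turnstile> (0 \<^bold>\<in> 0 \<^bold>\<longleftrightarrow> 0 \<^bold>\<sqsubseteq> Suc y \<^bold>\<and> compact 0)" by simp
      from IffD1[OF this s(1)] s(2)
      have "?\<Theta> \<turnstile> (0 \<^bold>\<sqsubseteq> Suc y \<^bold>\<and> compact 0 \<^bold>\<and> Suc x \<^bold>\<sqsubseteq> 0)"
        by (blast intro: ConI ConE1 ConE2)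
      then show "?\<Theta> \<turnstile> lift ?p" by (auto intro!: ExiI[where x = 0])
    qed
    then show "K # map liftS ?\<Gamma> \<turnstile> liftS ?p" by simp
  qed
qed

text \<open>For a directed set with supremum \<open>u\<close> above \<open>x\<close>, compactness
  applied to \<open>c \<sqsubseteq> x \<sqsubseteq> u\<close> yields a member \<open>s\<close> with
  \<open>c \<sqsubseteq> s\<close>, and then
  \<open>y \<sqsubseteq> c \<sqsubseteq> s\<close>.\<close>

lemma way_below_through_compact:
  "[y \<^bold>\<sqsubseteq> c, compact c, c \<^bold>\<sqsubseteq> x, dcpo] \<turnstile> (y \<^bold>\<lless> x)" (is "?\<Gamma> \<turnstile> _")
proof (rule way_belowI)
  let ?\<Delta> = "(Suc x \<^bold>\<sqsubseteq> 0) # supremum 0 0 # map lift (directed 0 # map liftS ?\<Gamma>)"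
  let ?q = "\<^bold>\<exists> (0 \<^bold>\<in> 0 \<^bold>\<and> Suc (Suc y) \<^bold>\<sqsubseteq> 0)"
  have "?\<Delta> \<turnstile> (Suc c \<^bold>\<sqsubseteq> 0)"
    by (rule dcpo_trans[where y = "Suc x"]) (simp_all add: Asm)
  moreover have "?\<Delta> \<turnstile> (Suc c \<^bold>\<lless> Suc c)" "?\<Delta> \<turnstile> directed 0" "?\<Delta> \<turnstile> supremum 0 0"
    by (simp_all add: Asm compact_def)
  ultimately have "?\<Delta> \<turnstile> \<^bold>\<exists> (0 \<^bold>\<in> 0 \<^bold>\<and> Suc (Suc c) \<^bold>\<sqsubseteq> 0)" by (blast intro: way_belowD)
  then show "?\<Delta> \<turnstile> ?q"
  proof (rule ExiE)
    let ?\<Theta> = "(0 \<^bold>\<in> 0 \<^bold>\<and> Suc (Suc c) \<^bold>\<sqsubseteq> 0) # map lift ?\<Delta>"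
    have "?\<Theta> \<turnstile> (0 \<^bold>\<in> 0 \<^bold>\<and> Suc (Suc c) \<^bold>\<sqsubseteq> 0)" by (simp add: Asm)
    then have "?\<Theta> \<turnstile> (0 \<^bold>\<in> 0)" "?\<Theta> \<turnstile> (Suc (Suc c) \<^bold>\<sqsubseteq> 0)" by (rule ConE1, rule ConE2)
    moreover have "?\<Theta> \<turnstile> dcpo" "?\<Theta> \<turnstile> (Suc (Suc y) \<^bold>\<sqsubseteq> Suc (Suc c))" by (simp_all add: Asm)
    ultimately have "?\<Theta> \<turnstile> (0 \<^bold>\<in> 0 \<^bold>\<and> Suc (Suc y) \<^bold>\<sqsubseteq> 0)" by (blast intro: ConI dcpo_trans)
    \<comment> \<open>The member found above \<open>c\<close> also serves as the witness for
      \<open>y\<close>.\<close>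
    then show "?\<Theta> \<turnstile> lift ?q" by (auto intro!: ExiI[where x = 0])
  qed
qed

text \<open>The interpolant gives \<open>x \<sqsubseteq> c \<sqsubseteq> y\<close>. This replaces
  the usual argument with the directed set \<open>{y}\<close>, which would call for another
  comprehension.\<close>

lemma way_below_imp_le:
  "[x \<^bold>\<lless> y, dcpo, algebraic] \<turnstile> (x \<^bold>\<sqsubseteq> y)" (is "?\<Gamma> \<turnstile> _")
  using compact_interpolation
proof (rule ExiE)
  let ?c = "0 \<^bold>\<sqsubseteq> Suc y \<^bold>\<and> compact 0 \<^bold>\<and> Suc x \<^bold>\<sqsubseteq> 0"
  have "?c # map lift ?\<Gamma> \<turnstile> ?c" "?c # map lift ?\<Gamma> \<turnstile> dcpo" by (simp_all add: Asm)
  then have "?c # map lift ?\<Gamma> \<turnstile> (Suc x \<^bold>\<sqsubseteq> Suc y)"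
    by (blast intro: dcpo_trans ConE1 ConE2)
  then show "?c # map lift ?\<Gamma> \<turnstile> lift (x \<^bold>\<sqsubseteq> y)" by simp
qed

section \<open>Sharpness and decidability\<close>

lemma sharp_imp_decidable:
  "[compact c, sharp x, dcpo, algebraic] \<turnstile> decidable (c \<^bold>\<sqsubseteq> x)" (is "?\<Gamma> \<turnstile> _")
proof -
  have "?\<Gamma> \<turnstile> sharp x" "?\<Gamma> \<turnstile> (c \<^bold>\<lless> c)" by (simp_all add: Asm compact_def)
  then have "?\<Gamma> \<turnstile> (c \<^bold>\<lless> x \<^bold>\<or> \<^bold>\<not> (c \<^bold>\<sqsubseteq> x))" by (rule sharpD)
  then show ?thesis unfolding decidable_def
  proof (rule DisE)
    \<comment> \<open>Sharpness yields \<open>c \<lless> x\<close>, whereas decidability asks for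
      \<open>c \<sqsubseteq> x\<close>.\<close>
    have "(c \<^bold>\<lless> x) # ?\<Gamma> \<turnstile> (c \<^bold>\<sqsubseteq> x)" by (rule weakening[OF way_below_imp_le]) auto
    then show "(c \<^bold>\<lless> x) # ?\<Gamma> \<turnstile> (c \<^bold>\<sqsubseteq> x \<^bold>\<or> \<^bold>\<not> (c \<^bold>\<sqsubseteq> x))" by (rule DisI1)
    show "(\<^bold>\<not> (c \<^bold>\<sqsubseteq> x)) # ?\<Gamma> \<turnstile> (c \<^bold>\<sqsubseteq> x \<^bold>\<or> \<^bold>\<not> (c \<^bold>\<sqsubseteq> x))" by (rule DisI2) (simp add: Asm)
  qed
qed

text \<open>Stated over an arbitrary context because it is applied after an existential has been
  opened, where \<open>c\<close> is the fresh variable \<open>0\<close>.\<close>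

lemma decidable_interpolant:
  assumes "\<Gamma> \<turnstile> dcpo" "\<Gamma> \<turnstile> (y \<^bold>\<sqsubseteq> c)" "\<Gamma> \<turnstile> compact c" "\<Gamma> \<turnstile> (c \<^bold>\<sqsubseteq> z)" "\<Gamma> \<turnstile> decidable (c \<^bold>\<sqsubseteq> x)"
  shows "\<Gamma> \<turnstile> (y \<^bold>\<lless> x \<^bold>\<or> \<^bold>\<not> (z \<^bold>\<sqsubseteq> x))"
  using assms(5) unfolding decidable_def
proof (rule DisE)
  have "(c \<^bold>\<sqsubseteq> x) # \<Gamma> \<turnstile> (y \<^bold>\<lless> x)"
    by (rule cut[OF way_below_through_compact[of y c x]])
      (use assms in \<open>auto intro: Asm weakening[of \<Gamma>]\<close>)
  then show "(c \<^bold>\<sqsubseteq> x) # \<Gamma> \<turnstile> (y \<^bold>\<lless> x \<^bold>\<or> \<^bold>\<not> (z \<^bold>\<sqsubseteq> x))" by (rule DisI1)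
next
  let ?\<Delta> = "(z \<^bold>\<sqsubseteq> x) # (\<^bold>\<not> (c \<^bold>\<sqsubseteq> x)) # \<Gamma>"
  \<comment> \<open>The chain \<open>c \<sqsubseteq> z \<sqsubseteq> x\<close> contradicts the
    assumption of this case.\<close>
  have "?\<Delta> \<turnstile> (c \<^bold>\<sqsubseteq> x)"
    by (rule dcpo_trans[where y = z]) (use assms in \<open>auto intro: Asm weakening[of \<Gamma>]\<close>)
  moreover have "?\<Delta> \<turnstile> (c \<^bold>\<sqsubseteq> x \<^bold>\<longrightarrow> \<^bold>\<bottom>)" by (simp add: Asm Neg_def)
  ultimately have "?\<Delta> \<turnstile> \<^bold>\<bottom>" by (blast intro: ImpE)
  then have "(\<^bold>\<not> (c \<^bold>\<sqsubseteq> x)) # \<Gamma> \<turnstile> (\<^bold>\<not> (z \<^bold>\<sqsubseteq> x))" unfolding Neg_def by (rule ImpI)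
  then show "(\<^bold>\<not> (c \<^bold>\<sqsubseteq> x)) # \<Gamma> \<turnstile> (y \<^bold>\<lless> x \<^bold>\<or> \<^bold>\<not> (z \<^bold>\<sqsubseteq> x))" by (rule DisI2)
qed

text \<open>This is the body of \<open>sharp x\<close> at fixed \<open>y\<close> and
  \<open>z\<close>; the decidability hypothesis is instantiated at the compact interpolant.\<close>

lemma decidable_imp_sharp_at:
  "[y \<^bold>\<lless> z, \<^bold>\<forall> (compact 0 \<^bold>\<longrightarrow> decidable (0 \<^bold>\<sqsubseteq> Suc x)), dcpo, algebraic]
    \<turnstile> (y \<^bold>\<lless> x \<^bold>\<or> \<^bold>\<not> (z \<^bold>\<sqsubseteq> x))" (is "?\<Gamma> \<turnstile> ?p")
proof -
  have "?\<Gamma> \<turnstile> \<^bold>\<exists> (0 \<^bold>\<sqsubseteq> Suc z \<^bold>\<and> compact 0 \<^bold>\<and> Suc y \<^bold>\<sqsubseteq> 0)"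
    by (rule weakening[OF compact_interpolation]) auto
  then show ?thesis
  proof (rule ExiE)
    let ?c = "0 \<^bold>\<sqsubseteq> Suc z \<^bold>\<and> compact 0 \<^bold>\<and> Suc y \<^bold>\<sqsubseteq> 0"
    let ?\<Delta> = "?c # map lift ?\<Gamma>"
    have "?\<Delta> \<turnstile> ?c" by (simp add: Asm)
    then have c: "?\<Delta> \<turnstile> (0 \<^bold>\<sqsubseteq> Suc z)" "?\<Delta> \<turnstile> compact 0" "?\<Delta> \<turnstile> (Suc y \<^bold>\<sqsubseteq> 0)"
      by (blast intro: ConE1 ConE2)+
    have "?\<Delta> \<turnstile> \<^bold>\<forall> (compact 0 \<^bold>\<longrightarrow> decidable (0 \<^bold>\<sqsubseteq> Suc (Suc x)))" by (simp add: Asm)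
    from AllE[OF this, of 0] have "?\<Delta> \<turnstile> (compact 0 \<^bold>\<longrightarrow> decidable (0 \<^bold>\<sqsubseteq> Suc x))" by simp
    from ImpE[OF this c(2)] have "?\<Delta> \<turnstile> decidable (0 \<^bold>\<sqsubseteq> Suc x)" .
    moreover have "?\<Delta> \<turnstile> dcpo" by (simp add: Asm)
    ultimately have "?\<Delta> \<turnstile> (Suc y \<^bold>\<lless> Suc x \<^bold>\<or> \<^bold>\<not> (Suc z \<^bold>\<sqsubseteq> Suc x))"
      using c by (blast intro: decidable_interpolant)
    then show "?\<Delta> \<turnstile> lift ?p" by simp
  qed
qed

theorem proposition5p11:
  shows "[dcpo, algebraic] \<turnstile>
    \<^bold>\<forall> (sharp 0 \<^bold>\<longleftrightarrow> \<^bold>\<forall> (compact 0 \<^bold>\<longrightarrow> decidable (0 \<^bold>\<sqsubseteq> 1)))"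
proof (rule AllI, rule IffI)
  let ?\<Gamma> = "map lift [dcpo, algebraic]"
  \<comment> \<open>The point is variable \<open>0\<close>; the quantifier over compact elements
    shifts it to \<open>1\<close> and takes \<open>0\<close> for \<open>c\<close>.\<close>
  have "map lift (sharp 0 # ?\<Gamma>) = [sharp 1, dcpo, algebraic]" by simp
  with sharp_imp_decidable[of 0 1]
  show "sharp 0 # ?\<Gamma> \<turnstile> \<^bold>\<forall> (compact 0 \<^bold>\<longrightarrow> decidable (0 \<^bold>\<sqsubseteq> 1))"
    by (metis AllI ImpI)
  \<comment> \<open>The two quantifiers of \<open>sharp\<close> shift the point to \<open>2\<close>,
    with \<open>y\<close> at \<open>1\<close> and \<open>z\<close> at \<open>0\<close>.\<close>
  show "\<^bold>\<forall> (compact 0 \<^bold>\<longrightarrow> decidable (0 \<^bold>\<sqsubseteq> 1)) # ?\<Gamma> \<turnstile> sharp 0"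
    unfolding sharp_def
    by (rule AllI, rule AllI, rule ImpI)
      (use decidable_imp_sharp_at[of 1 0 2] in \<open>simp add: eval_nat_numeral\<close>)
qed

end
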